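(* Let $d$ be a positive integer divisible by $3$. Then there exists a partition of $[5]^d$ into $25^{d/3}\leq 2.93^d$ odd proper sub-boxes.
   Context: For finite sets $A_1,\dots,A_d$ with $|A_i|\ge 2$, the set $A=A_1\times\cdots\times A_d$ is a $d$-dimensional discrete box. A sub-box of $A$ is a set $B=B_1\times\cdots\times B_d$ with $B_i\subseteq A_i$ for all $i$; it is proper if $B_i\neq A_i$ for every $i$, and odd if $|B_i|$ is odd for every $i$. Here $[5]=\{1,2,3,4,5\}$ and $[5]^d=[5]\times\cdots\times[5]$ ($d$ factors). A partition means the sub-boxes are pairwise disjoint and their union is the whole box. *)

theory Defs
  imports Complex_Main "HOL-Library.FuncSet" "HOL-Library.Disjoint_Sets"
begin

text \<open>
  The product \<open>A 1 \<times> \<dots> \<times> A d\<close>, with d-tuples represented as functions on \<open>{1..d}\<close>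
  (\<open>undefined\<close> elsewhere). The values of \<open>A\<close> outside \<open>{1..d}\<close> are irrelevant.
\<close>
definition cart_box :: "nat \<Rightarrow> (nat \<Rightarrow> 'a set) \<Rightarrow> (nat \<Rightarrow> 'a) set" where
  "cart_box d A = (\<Pi>\<^sub>E i\<in>{1..d}. A i)"

text \<open>
  Being proper or odd is a condition on the factors, so all the conditions are required of
  one family \<open>S\<close> of factors of \<open>B\<close>. This family is unique on \<open>{1..d}\<close>, since odd sets are
  nonempty.
\<close>
definition odd_proper_sub_box ::
    "nat \<Rightarrow> (nat \<Rightarrow> 'a set) \<Rightarrow> (nat \<Rightarrow> 'a) set \<Rightarrow> bool" where
  "odd_proper_sub_box d A B \<longleftrightarrow>
    (\<exists>S. B = cart_box d S \<and>
         (\<forall>i\<in>{1..d}. S i \<subseteq> A i) \<and>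
         (\<forall>i\<in>{1..d}. S i \<noteq> A i) \<and>
         (\<forall>i\<in>{1..d}. odd (card (S i))))"

end

theory Submission
  imports Defs
begin

text \<open>
  \<open>[5]\<^sup>3\<close> has a partition into 25 odd proper sub-boxes, found by a computer search.
  Grouping the \<open>d = 3k\<close> coordinates into \<open>k\<close> blocks of three, the products of boxes of this
  partition, one for each block, partition \<open>[5]\<^sup>d\<close> into \<open>25\<^sup>k\<close> boxes.
\<close>

text \<open>Coordinates of a box start at 1, while blocks and positions inside a block are counted
  from 0; hence the shift to \<open>i - 1\<close> before division with remainder by
  \<open>m\<close>. The choice \<open>g\<close> names one small box per block.\<close>

definition block_factors :: "nat \<Rightarrow> ('n \<Rightarrow> nat \<Rightarrow> 'a set) \<Rightarrow> (nat \<Rightarrow> 'n) \<Rightarrow> nat \<Rightarrow> 'a set" where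
  "block_factors m F g i = F (g ((i - 1) div m)) ((i - 1) mod m)"

lemma block_index_bound:
  fixes j k m r :: nat
  assumes "j < k" "r < m"
  shows "Suc (m * j + r) \<in> {1..m * k}"
proof -
  have "m * j + r < m * Suc j"
    using assms by simp
  also have "\<dots> \<le> m * k"
    using assms by (intro mult_le_mono2) simp
  finally show ?thesis
    by simp
qed

lemma block_index_cases:
  fixes i k m :: nat
  assumes "i \<in> {1..m * k}"
  obtains j r where "j < k" "r < m" "i = Suc (m * j + r)"
proof -
  have "m > 0"
    using assms by (cases m) auto
  moreover have "i - 1 < m * k"
    using assms by auto
  ultimately have "(i - 1) div m < k" "(i - 1) mod m < m" "i = Suc (m * ((i - 1) div m) + (i - 1) mod m)"
    using assms by (auto simp: div_less_iff_less_mult mult.commute)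
  then show thesis
    using that by blast
qed

lemma block_factors_Suc:
  assumes "r < m"
  shows "block_factors m F g (Suc (m * j + r)) = F (g j) r"
  using assms by (simp add: block_factors_def)

text \<open>Separates membership into independent conditions on the blocks, so that existence and
  uniqueness of the small box can be settled block by block.\<close>

lemma mem_cart_box_block_factors:
  "x \<in> cart_box (m * k) (block_factors m F g) \<longleftrightarrow>
    x \<in> extensional {1..m * k} \<and> (\<forall>j<k. \<forall>r<m. x (Suc (m * j + r)) \<in> F (g j) r)"
proof -
  have "(\<forall>i\<in>{1..m * k}. x i \<in> block_factors m F g i) \<longleftrightarrow>
      (\<forall>j<k. \<forall>r<m. x (Suc (m * j + r)) \<in> F (g j) r)"
    by (metis block_index_bound block_index_cases block_factors_Suc)
  then show ?thesis
    by (auto simp: cart_box_def PiE_def Pi_def)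
qed

text \<open>The assumption \<open>cover\<close> ignores the values of \<open>x\<close> from
  \<open>m\<close> on, so block \<open>j\<close> of a point can be inserted as the function of
  \<open>r\<close> with value \<open>x (Suc (m * j + r))\<close>, without restricting it. Boxes are
  indexed by the choices \<open>g\<close>, of which there are \<open>card N ^ k\<close>.\<close>

lemma block_product_partition:
  fixes F :: "'n \<Rightarrow> nat \<Rightarrow> 'a set"
  assumes "finite N"
    and cover: "\<And>x. (\<And>r. r < m \<Longrightarrow> x r \<in> A) \<Longrightarrow> \<exists>!n. n \<in> N \<and> (\<forall>r<m. x r \<in> F n r)"
    and F: "\<And>n r. n \<in> N \<Longrightarrow> r < m \<Longrightarrow> F n r \<subseteq> A \<and> F n r \<noteq> A \<and> odd (card (F n r))"
  shows "\<exists>P. partition_on (cart_box (m * k) (\<lambda>_. A)) P \<and> finite P \<and> card P = card N ^ k \<and>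
           (\<forall>B\<in>P. odd_proper_sub_box (m * k) (\<lambda>_. A) B)"
proof -
  let ?G = "{..<k} \<rightarrow>\<^sub>E N"
  let ?box = "\<lambda>g. cart_box (m * k) (block_factors m F g)"
  have factor: "block_factors m F g i \<subseteq> A \<and> block_factors m F g i \<noteq> A \<and> odd (card (block_factors m F g i))"
    if "g \<in> ?G" "i \<in> {1..m * k}" for g i
    using that(2)
  proof (rule block_index_cases)
    fix j r assume "j < k" "r < m" "i = Suc (m * j + r)"
    then show ?thesis
      using that(1) F by (auto simp: block_factors_Suc)
  qed
  \<comment> \<open>A factor of odd cardinality cannot be empty.\<close>
  have nonempty: "?box g \<noteq> {}" if "g \<in> ?G" for g
    using factor[OF that] by (fastforce simp: cart_box_def PiE_eq_empty_iff)
  have block_in: "x (Suc (m * j + r)) \<in> A"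
    if "x \<in> cart_box (m * k) (\<lambda>_. A)" "j < k" "r < m" for x j r
    using that block_index_bound by (fastforce simp: cart_box_def)
  have sub: "?box g \<subseteq> cart_box (m * k) (\<lambda>_. A)" if "g \<in> ?G" for g
    unfolding cart_box_def using factor[OF that] by (intro PiE_mono) blast
  \<comment> \<open>A common point determines the index in every block. This yields disjointness of
    distinct boxes and, as no box is empty, injectivity of the indexing, which the cardinality
    needs.\<close>
  have eq: "g = h" if "g \<in> ?G" "h \<in> ?G" "x \<in> ?box g" "x \<in> ?box h" for g h x
  proof (rule PiE_ext[OF that(1,2)])
    fix j assume "j \<in> {..<k}"
    then have "g j \<in> N" "h j \<in> N" "\<And>r. r < m \<Longrightarrow> x (Suc (m * j + r)) \<in> A"
      using that sub block_in by blast+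
    then show "g j = h j"
      using cover[of "\<lambda>r. x (Suc (m * j + r))"] that(3,4) \<open>j \<in> {..<k}\<close>
      by (auto simp: mem_cart_box_block_factors)
  qed
  have covered: "\<exists>g\<in>?G. x \<in> ?box g" if x: "x \<in> cart_box (m * k) (\<lambda>_. A)" for x
  proof -
    have "\<forall>j\<in>{..<k}. \<exists>n. n \<in> N \<and> (\<forall>r<m. x (Suc (m * j + r)) \<in> F n r)"
      using cover[of "\<lambda>r. x (Suc (m * _ + r))"] block_in[OF x] by blast
    then obtain g where "\<forall>j\<in>{..<k}. g j \<in> N \<and> (\<forall>r<m. x (Suc (m * j + r)) \<in> F (g j) r)"
      by metis
    \<comment> \<open>The chosen \<open>g\<close> is arbitrary outside \<open>{..<k}\<close>;
      restricting it makes it one of the functions being counted.\<close>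
    then have "restrict g {..<k} \<in> ?G" "x \<in> ?box (restrict g {..<k})"
      using x by (auto simp: mem_cart_box_block_factors) (auto simp: cart_box_def PiE_def)
    then show ?thesis
      by blast
  qed
  have "inj_on ?box ?G"
  proof (rule inj_onI)
    fix g h assume gh: "g \<in> ?G" "h \<in> ?G" "?box g = ?box h"
    obtain x where "x \<in> ?box g"
      using nonempty[OF gh(1)] by blast
    then show "g = h"
      using eq[OF gh(1,2)] gh(3) by simp
  qed
  then have "card (?box ` ?G) = card N ^ k"
    by (simp add: card_image card_PiE)
  moreover have "partition_on (cart_box (m * k) (\<lambda>_. A)) (?box ` ?G)"
  proof (rule partition_onI)
    show "\<Union> (?box ` ?G) = cart_box (m * k) (\<lambda>_. A)"
    proof
      show "\<Union> (?box ` ?G) \<subseteq> cart_box (m * k) (\<lambda>_. A)"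
        using sub by (rule UN_least)
      show "cart_box (m * k) (\<lambda>_. A) \<subseteq> \<Union> (?box ` ?G)"
        using covered by (intro subsetI UN_iff[THEN iffD2])
    qed
  next
    fix B C assume "B \<in> ?box ` ?G" "C \<in> ?box ` ?G" "B \<noteq> C"
    then obtain g h where gh: "g \<in> ?G" "h \<in> ?G" "B = ?box g" "C = ?box h" "g \<noteq> h"
      by (elim imageE) metis
    show "disjnt B C"
      unfolding disjnt_iff gh(3,4) using eq[OF gh(1,2)] gh(5) by metis
  next
    show "{} \<notin> ?box ` ?G"
      using nonempty by (metis imageE)
  qed
  moreover have "finite (?box ` ?G)"
    using \<open>finite N\<close> by (intro finite_imageI finite_PiE) auto
  moreover have "\<forall>B\<in>?box ` ?G. odd_proper_sub_box (m * k) (\<lambda>_. A) B"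
    unfolding odd_proper_sub_box_def using factor by blast
  ultimately show ?thesis
    by blast
qed

text \<open>Each row lists the three factors of one box. A partition of [5] into odd proper subsets
  has at least 3 parts, since their number is odd and not 1, so products of such partitions give at
  least 27 boxes; this one saves two.\<close>

definition boxes25 :: "nat list list list" where
  "boxes25 =
  [[[1], [1, 2, 5], [2, 4, 5]],
   [[2], [1], [3]],
   [[2], [4], [1, 3, 5]],
   [[2], [2, 3, 5], [3, 4, 5]],
   [[2], [3, 4, 5], [2]],
   [[3], [2], [1, 3, 5]],
   [[3], [5], [1, 2, 5]],
   [[3], [1, 3, 4], [1]],
   [[3], [2, 4, 5], [4]],
   [[4], [4], [3]],
   [[4], [1, 3, 5], [3]],
   [[4], [2, 4, 5], [2, 4, 5]],
   [[5], [2], [1, 4, 5]],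
   [[5], [1, 3, 5], [4]],
   [[5], [1, 3, 5], [1, 2, 5]],
   [[1, 2, 4], [2], [1]],
   [[1, 2, 4], [1, 3, 5], [1]],
   [[1, 2, 5], [4], [4]],
   [[1, 3, 4], [3], [2, 4, 5]],
   [[1, 3, 5], [4], [2, 3, 5]],
   [[1, 3, 5], [1, 3, 5], [3]],
   [[1, 4, 5], [2], [3]],
   [[1, 4, 5], [4], [1]],
   [[2, 3, 4], [1], [2, 4, 5]],
   [[2, 3, 5], [2], [2]]]"

text \<open>A count of 1 at each of the 125 points gives covering and disjointness together. Lists
  in place of sets and of unique existence keep the check executable.\<close>

lemma boxes25_cover:
  "\<forall>a\<in>set [1..<6]. \<forall>b\<in>set [1..<6]. \<forall>c\<in>set [1..<6].
     length (filter (\<lambda>n. a \<in> set (boxes25 ! n ! 0) \<and> b \<in> set (boxes25 ! n ! 1) \<and>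
       c \<in> set (boxes25 ! n ! 2)) [0..<25]) = 1"
  by code_simp

lemma boxes25_odd_proper:
  "\<forall>n\<in>set [0..<25]. \<forall>r\<in>set [0..<3]. set (boxes25 ! n ! r) \<subseteq> set [1..<6] \<and>
     set (boxes25 ! n ! r) \<noteq> set [1..<6] \<and> odd (card (set (boxes25 ! n ! r)))"
  by code_simp

theorem theorem1p3:
  fixes d :: nat
  assumes "d > 0" and "3 dvd d"
  shows "(\<exists>P. partition_on (cart_box d (\<lambda>_. {1..5::nat})) P \<and>
              finite P \<and> card P = 25 ^ (d div 3) \<and>
              (\<forall>B\<in>P. odd_proper_sub_box d (\<lambda>_. {1..5::nat}) B)) \<and>
         (25::real) ^ (d div 3) \<le> 2.93 ^ d"
proof -
  obtain k where d: "d = 3 * k"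
    using assms(2) by blast
  let ?F = "\<lambda>n r. set (boxes25 ! n ! r)"
  have set_eq: "{1..5::nat} = set [1..<6]" "{..<25::nat} = set [0..<25]"
    by auto
  have all3: "(\<forall>r<3. Q r) \<longleftrightarrow> Q 0 \<and> Q 1 \<and> Q 2" for Q :: "nat \<Rightarrow> bool"
    by (simp add: numeral_3_eq_3 numeral_2_eq_2 All_less_Suc2)
  have "\<exists>P. partition_on (cart_box (3 * k) (\<lambda>_. {1..5::nat})) P \<and> finite P \<and>
      card P = card {..<25::nat} ^ k \<and> (\<forall>B\<in>P. odd_proper_sub_box (3 * k) (\<lambda>_. {1..5::nat}) B)"
  proof (rule block_product_partition[where F = ?F])
    fix x :: "nat \<Rightarrow> nat"
    assume x: "\<And>r. r < 3 \<Longrightarrow> x r \<in> {1..5}"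
    let ?Q = "\<lambda>n. x 0 \<in> ?F n 0 \<and> x 1 \<in> ?F n 1 \<and> x 2 \<in> ?F n 2"
    have "length (filter ?Q [0..<25]) = 1"
      using boxes25_cover x unfolding set_eq by simp
    then obtain n where "filter ?Q [0..<25] = [n]"
      by (auto simp: length_Suc_conv)
    \<comment> \<open>A filtered list with one entry becomes a singleton set, which is unique
      existence.\<close>
    then have "{n \<in> {..<25}. ?Q n} = {n}"
      unfolding set_eq set_filter[symmetric] by simp
    then show "\<exists>!n. n \<in> {..<25} \<and> (\<forall>r<3. x r \<in> ?F n r)"
      unfolding all3 by (intro ex1I[of _ n]) blast+
  next
    fix n r :: nat
    assume "n \<in> {..<25}" "r < 3"
    then show "?F n r \<subseteq> {1..5} \<and> ?F n r \<noteq> {1..5} \<and> odd (card (?F n r))"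
      unfolding set_eq using boxes25_odd_proper by simp
  qed simp
  \<comment> \<open>Numerically, 2.93 cubed is 25.153757.\<close>
  moreover have "(25::real) ^ k \<le> (2.93 ^ 3) ^ k"
    by (intro power_mono) (simp_all add: power3_eq_cube)
  ultimately show ?thesis
    by (simp add: d power_mult)
qed

end
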